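(* Let $V$ be a simple vertex operator algebra and $G$ a finite subgroup of $\mathrm{Aut}(V)$. Then $\mathrm{Gal}(V/V^G)=G$.
   Context: $V^G=\{v\in V: gv=v\ \forall g\in G\}$. For a vertex operator subalgebra $U\subseteq V$, the Galois group is $\mathrm{Gal}(V/U)=\{g\in\mathrm{Aut}(V): g|_U=\mathrm{id}\}$, where $\mathrm{Aut}(V)$ is the group of vertex operator algebra automorphisms of $V$. *)

theory Defs
  imports Complex_Main "HOL-Algebra.Group"
begin

text \<open>A vertex operator algebra over the complex numbers.
  The underlying space is a type 'v with a complex scalar multiplication sc.
  The vertex operator is given by its modes: Y u n v is u_n v, where
  Y(u,z) = sum over n of u_n z^(-n-1).  vac is the vacuum vector, om the
  conformal vector, c the central charge, and L(n) = om_(n+1).\<close>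

definition VOA_grade ::
  "(complex \<Rightarrow> 'v::ab_group_add \<Rightarrow> 'v) \<Rightarrow> ('v \<Rightarrow> int \<Rightarrow> 'v \<Rightarrow> 'v) \<Rightarrow> 'v \<Rightarrow> int \<Rightarrow> 'v set" where
  "VOA_grade sc Y om n = {v. Y om 1 v = sc (of_int n) v}"

definition is_VOA ::
  "(complex \<Rightarrow> 'v::ab_group_add \<Rightarrow> 'v) \<Rightarrow> ('v \<Rightarrow> int \<Rightarrow> 'v \<Rightarrow> 'v) \<Rightarrow> 'v \<Rightarrow> 'v \<Rightarrow> complex \<Rightarrow> bool" where
  "is_VOA sc Y vac om c \<longleftrightarrow>
     vector_space sc
     \<comment> \<open>bilinearity of (u,v) \<mapsto> u_n v\<close>
   \<and> (\<forall>u n. Vector_Spaces.linear sc sc (Y u n))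
   \<and> (\<forall>n v. Vector_Spaces.linear sc sc (\<lambda>u. Y u n v))
     \<comment> \<open>truncation\<close>
   \<and> (\<forall>u v. \<exists>N. \<forall>n\<ge>N. Y u n v = 0)
     \<comment> \<open>vacuum property: Y(1,z) = id\<close>
   \<and> (\<forall>n v. Y vac n v = (if n = -1 then v else 0))
     \<comment> \<open>creation property\<close>
   \<and> (\<forall>u n. n \<ge> 0 \<longrightarrow> Y u n vac = 0)
   \<and> (\<forall>u. Y u (-1) vac = u)
     \<comment> \<open>Jacobi identity (in components, Borcherds identity); all sums are finite
         by truncation, so they stabilise\<close>
   \<and> (\<forall>u v w p q r. \<exists>N. \<forall>M\<ge>N.
        (\<Sum>i<M. sc ((of_int p :: complex) gchoose i) (Y (Y u (r + int i) v) (p + q - int i) w))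
      = (\<Sum>i<M. sc ((-1) ^ i * ((of_int r :: complex) gchoose i))
            (Y u (p + r - int i) (Y v (q + int i) w)
             - sc ((-1::complex) powi r) (Y v (q + r - int i) (Y u (p + int i) w)))))
     \<comment> \<open>Virasoro relations, L(n) = om_(n+1), central charge c\<close>
   \<and> (\<forall>m n w. Y om (m + 1) (Y om (n + 1) w) - Y om (n + 1) (Y om (m + 1) w)
        = sc (of_int (m - n)) (Y om (m + n + 1) w)
          + (if m + n = 0 then sc ((of_int m ^ 3 - of_int m) / 12 * c) w else 0))
     \<comment> \<open>L(-1)-derivative property: Y(L(-1)u,z) = d/dz Y(u,z)\<close>
   \<and> (\<forall>u n. Y (Y om 0 u) n = (\<lambda>w. sc (- of_int n) (Y u (n - 1) w)))
     \<comment> \<open>grading by L(0)-eigenvalues: V is the (direct) sum of the V_n\<close>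
   \<and> module.span sc (\<Union>n. VOA_grade sc Y om n) = UNIV
     \<comment> \<open>each V_n finite dimensional\<close>
   \<and> (\<forall>n. \<exists>B. finite B \<and> B \<subseteq> VOA_grade sc Y om n \<and> VOA_grade sc Y om n \<subseteq> module.span sc B)
     \<comment> \<open>grading bounded below\<close>
   \<and> (\<exists>N. \<forall>n<N. VOA_grade sc Y om n = {0})"

definition simple_VOA ::
  "(complex \<Rightarrow> 'v::ab_group_add \<Rightarrow> 'v) \<Rightarrow> ('v \<Rightarrow> int \<Rightarrow> 'v \<Rightarrow> 'v) \<Rightarrow> 'v \<Rightarrow> 'v \<Rightarrow> complex \<Rightarrow> bool" where
  "simple_VOA sc Y vac om c \<longleftrightarrow> is_VOA sc Y vac om c \<and> (UNIV :: 'v set) \<noteq> {0}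
     \<and> (\<forall>I. module.subspace sc I \<longrightarrow> (\<forall>u n x. x \<in> I \<longrightarrow> Y u n x \<in> I)
            \<longrightarrow> I = {0} \<or> I = UNIV)"

definition VOA_Aut ::
  "(complex \<Rightarrow> 'v::ab_group_add \<Rightarrow> 'v) \<Rightarrow> ('v \<Rightarrow> int \<Rightarrow> 'v \<Rightarrow> 'v) \<Rightarrow> 'v \<Rightarrow> ('v \<Rightarrow> 'v) set" where
  "VOA_Aut sc Y om = {g. Vector_Spaces.linear sc sc g \<and> bij g
      \<and> (\<forall>u n v. g (Y u n v) = Y (g u) n (g v)) \<and> g om = om}"

definition VOA_Aut_group ::
  "(complex \<Rightarrow> 'v::ab_group_add \<Rightarrow> 'v) \<Rightarrow> ('v \<Rightarrow> int \<Rightarrow> 'v \<Rightarrow> 'v) \<Rightarrow> 'v \<Rightarrow> ('v \<Rightarrow> 'v) monoid" where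
  "VOA_Aut_group sc Y om = \<lparr>carrier = VOA_Aut sc Y om, mult = (\<circ>), one = id\<rparr>"

definition fixed_points :: "('v \<Rightarrow> 'v) set \<Rightarrow> 'v set" where
  "fixed_points G = {v. \<forall>g\<in>G. g v = v}"

definition VOA_Gal ::
  "(complex \<Rightarrow> 'v::ab_group_add \<Rightarrow> 'v) \<Rightarrow> ('v \<Rightarrow> int \<Rightarrow> 'v \<Rightarrow> 'v) \<Rightarrow> 'v \<Rightarrow> 'v set \<Rightarrow> ('v \<Rightarrow> 'v) set" where
  "VOA_Gal sc Y om U = {g \<in> VOA_Aut sc Y om. \<forall>u\<in>U. g u = u}"

end

theory Submission
  imports Defs "HOL-Computational_Algebra.Fundamental_Theorem_Algebra"
begin

text \<open>
  Automorphisms of a simple vertex operator algebra satisfy Dedekind's independence theorem, as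
  field automorphisms do. The multiplicativity used in Dedekind's argument is replaced by the
  nondegeneracy of the vertex operator: if the \<open>b\<close> are linearly independent and
  \<open>\<Sum>\<^sub>b Y(x\<^sub>b, z) b = 0\<close>, then every \<open>x\<^sub>b\<close> vanishes. Indeed, by the Borcherds identity the families
  \<open>x\<close> annihilated in this way form a module under the modes, so simplicity and Schur's lemma apply.
  Now if \<open>h\<close> fixes \<open>V\<^sup>G\<close> pointwise, then \<open>\<Sum>\<^sub>g h g = \<Sum>\<^sub>g g\<close>, since the right-hand side maps \<open>V\<close>
  into \<open>V\<^sup>G\<close>; independence forces the cosets \<open>h G\<close> and \<open>G\<close> to meet.
\<close>

section \<open>Eigenvectors from finite-dimensional orbits\<close>

text \<open>Take a nonzero polynomial \<open>q\<close> of least degree with q(f) v = 0 and split off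
  a root \<open>z\<close>: by minimality the cofactor \<open>r\<close> has r(f) v nonzero, and this
  vector is the eigenvector. Confining the orbit of a single vector suffices, so the whole space may
  be infinite-dimensional.\<close>

lemma (in vector_space) poly_annihilator_root:
  fixes q :: "'a poly"
  assumes f: "Vector_Spaces.linear scale scale f"
    and alg_closed: "\<And>q :: 'a poly. degree q > 0 \<Longrightarrow> \<exists>z. poly q z = 0"
    and S: "finite S" and orb: "\<And>i. (f ^^ i) v \<in> span S" and v: "v \<noteq> 0"
  shows "\<exists>z y. y \<noteq> 0 \<and> f y = scale z y"
proof -
  interpret f: Vector_Spaces.linear scale scale f by (rule f)
  \<comment> \<open>\<open>E q\<close> is q(f) v, evaluated by Horner's scheme.\<close>
  define E :: "'a poly \<Rightarrow> 'b" where "E = (\<lambda>q. fold_coeffs (\<lambda>a y. scale a v + f y) q 0)"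
  have E0: "E 0 = 0" by (simp add: E_def)
  have E_pCons: "E (pCons a q) = scale a v + f (E q)" for a q
    by (cases "a = 0"; cases "q = 0") (auto simp: E_def f.zero)
  have E_add: "E (p + q) = E p + E q" for p q
    by (induction p q rule: poly_induct2) (auto simp: E0 E_pCons scale_left_distrib f.add)
  have E_diff: "E (p - q) = E p - E q" for p q
    by (induction p q rule: poly_induct2) (auto simp: E0 E_pCons scale_left_diff_distrib f.diff)
  have E_smult: "E (smult a q) = scale a (E q)" for a q
    by (induction q) (auto simp: E0 E_pCons scale_right_distrib f.scale)
  have E_monom: "E (monom a i) = scale a ((f ^^ i) v)" for a i
    by (induction i) (auto simp: E_pCons monom_0 monom_Suc E0 f.zero f.scale)
  have E_sum: "E (\<Sum>i\<in>I. F i) = (\<Sum>i\<in>I. E (F i))" if "finite I" for I and F :: "nat \<Rightarrow> 'a poly"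
    using that by induction (auto simp: E0 E_add)
  have "\<exists>q. q \<noteq> 0 \<and> E q = 0"
  \<comment> \<open>\<open>dependent\<close> speaks of sets, so coinciding iterates are treated
    apart: they give the polynomial X^i - X^j. Otherwise infinitely many distinct iterates lie in a
    finite-dimensional span.\<close>
  proof (cases "inj (\<lambda>i. (f ^^ i) v)")
    case False
    then obtain i j where ij: "i \<noteq> j" "(f ^^ i) v = (f ^^ j) v" by (auto simp: inj_def)
    have "E (monom 1 i + smult (-1) (monom 1 j)) = 0"
      unfolding E_add E_smult E_monom by (simp add: ij)
    moreover have "coeff (monom 1 i + smult (-1) (monom 1 j)) i \<noteq> (0::'a)" using ij by simp
    ultimately show ?thesis by (metis coeff_0)
  next
    case True
    have "dependent (range (\<lambda>i. (f ^^ i) v))"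
    proof (rule ccontr)
      assume "independent (range (\<lambda>i. (f ^^ i) v))"
      moreover have "range (\<lambda>i. (f ^^ i) v) \<subseteq> span S" using orb by auto
      ultimately have "finite (range (\<lambda>i. (f ^^ i) v))"
        using independent_span_bound[OF S] by blast
      thus False using finite_imageD[OF _ True] by simp
    qed
    then obtain t u where t: "finite t" "t \<subseteq> range (\<lambda>i. (f ^^ i) v)"
      "(\<Sum>w\<in>t. scale (u w) w) = 0" and "\<exists>w\<in>t. u w \<noteq> 0"
      unfolding dependent_explicit by blast
    then obtain w0 where w0: "w0 \<in> t" "u w0 \<noteq> 0" by blast
    obtain I where I: "finite I" "t = (\<lambda>i. (f ^^ i) v) ` I"
      using finite_subset_image[OF t(1,2)] by auto
    define q where "q = (\<Sum>i\<in>I. monom (u ((f ^^ i) v)) i)"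
    have "E q = (\<Sum>w\<in>t. scale (u w) w)"
      unfolding q_def I(2) using True
      by (subst sum.reindex) (auto simp: E_sum I(1) E_monom intro: inj_on_subset)
    moreover have "q \<noteq> 0"
    proof -
      obtain i where i: "i \<in> I" "w0 = (f ^^ i) v" using w0 I by auto
      have "coeff q i = u w0" using i I(1) by (simp add: q_def coeff_sum)
      thus ?thesis using w0 by auto
    qed
    ultimately show ?thesis using t(3) by auto
  qed
  then obtain q where q: "q \<noteq> 0" "E q = 0"
    and q_min: "\<And>r. r \<noteq> 0 \<Longrightarrow> E r = 0 \<Longrightarrow> degree q \<le> degree r"
    using ex_has_least_nat[of "\<lambda>q. q \<noteq> 0 \<and> E q = 0" _ degree] by metis
  have "degree q > 0"
  proof (rule ccontr)
    assume "\<not> degree q > 0"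
    then obtain a where "q = [:a:]" using degree_eq_zeroE by blast
    thus False using q v by (simp add: E_pCons E0 f.zero)
  qed
  then obtain z where "poly q z = 0" using alg_closed by blast
  then obtain r where r: "q = [:- z, 1:] * r" using poly_eq_0_iff_dvd by blast
  have "r \<noteq> 0" using q r by auto
  hence "degree q = Suc (degree r)" unfolding r by (subst degree_mult_eq) auto
  hence "E r \<noteq> 0" using q_min[OF \<open>r \<noteq> 0\<close>] by auto
  moreover have "E q = scale (- z) (E r) + f (E r)"
    by (simp add: r E_diff E_smult E_pCons E_add)
  ultimately show ?thesis using q(2) by (auto simp: add_eq_0_iff)
qed

section \<open>Simple vertex operator algebras and Schur's lemma\<close>

locale simple_vertex_operator_algebra = vector_space sc
  for sc :: "complex \<Rightarrow> 'v::ab_group_add \<Rightarrow> 'v" +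
  fixes Y :: "'v \<Rightarrow> int \<Rightarrow> 'v \<Rightarrow> 'v" and vac om :: 'v and c :: complex
  assumes simple: "simple_VOA sc Y vac om c"
begin

lemmas VOA = simple[unfolded simple_VOA_def is_VOA_def]

lemma linear_right: "Vector_Spaces.linear sc sc (Y u n)"
  using VOA by (elim conjE allE) assumption

lemma linear_left: "Vector_Spaces.linear sc sc (\<lambda>u. Y u n v)"
  using VOA by (elim conjE allE) assumption

sublocale Yr: Vector_Spaces.linear sc sc "Y u n" for u n
  by (rule linear_right)

sublocale Yl: Vector_Spaces.linear sc sc "\<lambda>u. Y u n v" for n v
  by (rule linear_left)

lemma truncation: "\<exists>N. \<forall>n\<ge>N. Y u n v = 0"
  using VOA by (elim conjE allE) assumption

lemma vacuum: "Y vac n v = (if n = -1 then v else 0)"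
  using VOA by (elim conjE allE) assumption

lemma creation_nonneg: "n \<ge> 0 \<Longrightarrow> Y u n vac = 0"
  using VOA by (elim conjE allE) (erule mp)

lemma creation: "Y u (-1) vac = u"
  using VOA by (elim conjE allE) assumption

lemma borcherds:
  "\<exists>N. \<forall>M\<ge>N.
     (\<Sum>i<M. sc ((of_int p :: complex) gchoose i) (Y (Y u (r + int i) v) (p + q - int i) w))
   = (\<Sum>i<M. sc ((-1) ^ i * ((of_int r :: complex) gchoose i))
        (Y u (p + r - int i) (Y v (q + int i) w)
         - sc ((-1::complex) powi r) (Y v (q + r - int i) (Y u (p + int i) w))))"
  using VOA by (elim conjE allE) assumption

lemma grade_finite: "\<exists>B. finite B \<and> B \<subseteq> VOA_grade sc Y om n \<and> VOA_grade sc Y om n \<subseteq> span B"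
  using VOA by (elim conjE allE) assumption

lemma ideal_UNIV:
  assumes "subspace I" "\<And>u n x. x \<in> I \<Longrightarrow> Y u n x \<in> I" "x \<in> I" "x \<noteq> 0"
  shows "I = UNIV"
  using simple assms unfolding simple_VOA_def by blast

lemma vac_nonzero: "vac \<noteq> 0"
proof
  assume "vac = 0"
  hence "u = 0" for u :: 'v using creation[of u] by (simp add: Yr.zero)
  thus False using simple unfolding simple_VOA_def by blast
qed

text \<open>As \<open>f\<close> commutes with \<open>Y om 1\<close>, which kills \<open>vac\<close>,
  all iterates of \<open>f\<close> on \<open>vac\<close> stay in the finite-dimensional weight-zero
  space, so \<open>f\<close> has an eigenvector. The eigenspace is stable under all modes, hence
  everything by simplicity.\<close>

lemma schur:
  assumes f: "Vector_Spaces.linear sc sc f" and comm: "\<And>u n v. f (Y u n v) = Y u n (f v)"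
  shows "\<exists>z. \<forall>v. f v = sc z v"
proof -
  interpret f: Vector_Spaces.linear sc sc f by (rule f)
  obtain S where S: "finite S" "VOA_grade sc Y om 0 \<subseteq> span S" using grade_finite by blast
  have "(f ^^ i) vac \<in> VOA_grade sc Y om 0" for i
  proof -
    have "Y om 1 ((f ^^ i) vac) = 0"
      by (induction i) (auto simp: creation_nonneg comm[symmetric] f.zero)
    thus ?thesis by (simp add: VOA_grade_def)
  qed
  then obtain z y where y: "y \<noteq> 0" "f y = sc z y"
    using poly_annihilator_root[OF f _ S(1) _ vac_nonzero] S(2) fundamental_theorem_of_algebra
    by (metis (no_types, lifting) constant_degree neq0_conv subsetD)
  have "{v. f v = sc z v} = UNIV"
  proof (rule ideal_UNIV)
    show "subspace {v. f v = sc z v}"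
      by (rule subspaceI) (auto simp: f.zero f.add f.scale scale_right_distrib mult.commute)
  qed (use y in \<open>auto simp: comm Yr.scale\<close>)
  thus ?thesis by blast
qed

section \<open>Nondegeneracy of the vertex operator\<close>

text \<open>For independent \<open>B\<close>, a family \<open>x\<close> encodes the element of V
  tensor span \<open>B\<close> with components \<open>x b\<close>, and the set is the kernel of the
  vertex operator there. Entries outside \<open>B\<close> are unconstrained, hence the restrictions
  to members of \<open>B\<close> below.\<close>

definition annihilator :: "'v set \<Rightarrow> ('v \<Rightarrow> 'v) set" where
  "annihilator B = {x. \<forall>n. (\<Sum>b\<in>B. Y (x b) n b) = 0}"

text \<open>Downward induction on \<open>r\<close>: truncation and finiteness of \<open>B\<close>
  settle all large \<open>r\<close> at once, and the Borcherds identity reduces each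
  \<open>r\<close> to the larger ones.\<close>

lemma annihilator_Y:
  assumes B: "finite B" and x: "x \<in> annihilator B"
  shows "(\<lambda>b. Y u r (x b)) \<in> annihilator B"
proof -
  define T where "T = (\<lambda>r m. \<Sum>b\<in>B. Y (Y u r (x b)) m b)"
  obtain p1 where p1: "\<And>b n. n \<ge> p1 b \<Longrightarrow> Y u n b = 0"
    using truncation by metis
  have "\<forall>b. \<exists>N. \<forall>n\<ge>N. Y u n (x b) = 0" using truncation by blast
  then obtain R1 where R1: "\<And>b n. n \<ge> R1 b \<Longrightarrow> Y u n (x b) = 0" by metis
  obtain p where p: "\<And>b. b \<in> B \<Longrightarrow> p1 b \<le> p"
    using bdd_above_finite[of "p1 ` B"] B by (auto simp: bdd_above_def)
  obtain R where R: "\<And>b. b \<in> B \<Longrightarrow> R1 b \<le> R"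
    using bdd_above_finite[of "R1 ` B"] B by (auto simp: bdd_above_def)
  have T_large: "T r m = 0" if "r \<ge> R" for r m
    unfolding T_def using that by (intro sum.neutral ballI) (auto dest!: R simp: R1 Yl.zero)
  \<comment> \<open>Choosing \<open>p\<close> with \<open>u\<^sub>p\<^sub>+\<^sub>i b = 0\<close> for all \<open>b\<close> and \<open>i \<ge> 0\<close>, the right-hand side of the Borcherds identity
    sums to zero over \<open>B\<close>, while its left-hand side is \<open>T r m\<close> plus terms with larger \<open>r\<close>.\<close>
  have T_step: "T r m = 0" if higher: "\<And>r' m. r' > r \<Longrightarrow> T r' m = 0" for r m
  proof -
    \<comment> \<open>With this \<open>q\<close> the term \<open>i = 0\<close> on the left has outer
      mode p + q = m, so it is \<open>T r m\<close>.\<close>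
    define q where "q = m - p"
    let ?L = "\<lambda>M b. \<Sum>i<M. sc ((of_int p :: complex) gchoose i)
      (Y (Y u (r + int i) (x b)) (p + q - int i) b)"
    let ?c = "\<lambda>i. (-1) ^ i * ((of_int r :: complex) gchoose i)"
    let ?R = "\<lambda>M b. \<Sum>i<M. sc (?c i)
      (Y u (p + r - int i) (Y (x b) (q + int i) b)
       - sc ((-1::complex) powi r) (Y (x b) (q + r - int i) (Y u (p + int i) b)))"
    have "\<exists>N. \<forall>b. \<forall>M\<ge>N b. ?L M b = ?R M b"
      by (intro choice allI borcherds)
    then obtain N where "\<forall>b. \<forall>M\<ge>N b. ?L M b = ?R M b" ..
    hence N: "\<And>b M. M \<ge> N b \<Longrightarrow> ?L M b = ?R M b" by blast
    obtain N' where N': "\<And>b. b \<in> B \<Longrightarrow> N b \<le> N'"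
      using bdd_above_finite[of "N ` B"] B by (auto simp: bdd_above_def)
    \<comment> \<open>\<open>Suc\<close> keeps the sum nonempty, so that it contains the surviving
      index 0.\<close>
    define M where "M = Suc N'"
    have "(\<Sum>b\<in>B. ?L M b) = (\<Sum>i<M. sc ((of_int p :: complex) gchoose i) (T (r + int i) (p + q - int i)))"
      unfolding T_def by (subst sum.swap) (simp add: scale_sum_right)
    also have "\<dots> = (\<Sum>i\<in>{0}. sc ((of_int p :: complex) gchoose i) (T (r + int i) (p + q - int i)))"
      by (rule sum.mono_neutral_right) (auto simp: M_def higher)
    also have "\<dots> = T r m" by (simp add: q_def)
    finally have "T r m = (\<Sum>b\<in>B. ?L M b)" by simp
    also have "\<dots> = (\<Sum>b\<in>B. ?R M b)"
      by (intro sum.cong refl N) (auto dest: N' simp: M_def)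
    also have "\<dots> = (\<Sum>b\<in>B. \<Sum>i<M. sc (?c i) (Y u (p + r - int i) (Y (x b) (q + int i) b)))"
    proof (intro sum.cong refl)
      fix b i assume "b \<in> B"
      hence "Y u (p + int i) b = 0" using p by (intro p1) force
      thus "sc (?c i) (Y u (p + r - int i) (Y (x b) (q + int i) b)
           - sc ((-1::complex) powi r) (Y (x b) (q + r - int i) (Y u (p + int i) b)))
         = sc (?c i) (Y u (p + r - int i) (Y (x b) (q + int i) b))"
        by (simp add: Yr.zero)
    qed
    also have "\<dots> = (\<Sum>i<M. sc (?c i) (Y u (p + r - int i) (\<Sum>b\<in>B. Y (x b) (q + int i) b)))"
      by (subst sum.swap) (simp add: scale_sum_right Yr.sum)
    also have "\<dots> = 0" using x by (simp add: annihilator_def Yr.zero)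
    finally show ?thesis .
  qed
  have "T r m = 0" for r m
  proof (induction "nat (R - r)" arbitrary: r m rule: less_induct)
    case less
    show ?case
    proof (cases "r \<ge> R")
      case False
      show ?thesis by (rule T_step, rule less) (use False in auto)
    qed (rule T_large)
  qed
  thus ?thesis by (simp add: annihilator_def T_def)
qed

lemma annihilator_add: "x \<in> annihilator B \<Longrightarrow> y \<in> annihilator B \<Longrightarrow> (\<lambda>b. x b + y b) \<in> annihilator B"
  by (simp add: annihilator_def Yl.add sum.distrib)

lemma annihilator_scale: "x \<in> annihilator B \<Longrightarrow> (\<lambda>b. sc a (x b)) \<in> annihilator B"
  by (simp add: annihilator_def Yl.scale flip: scale_sum_right)

text \<open>Induction on \<open>B\<close>. If some \<open>x a\<close> were nonzero, the annihilating
  families would form the graph of maps commuting with all modes; by Schur these are scalars, which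
  yield a linear relation on the basis vectors themselves.\<close>

lemma vertex_operator_nondegenerate:
  assumes "finite B" "independent B" "x \<in> annihilator B" "b \<in> B"
  shows "x b = 0"
  using assms
proof (induction B arbitrary: x b rule: finite_induct)
  case (insert a B)
  let ?K = "annihilator (insert a B)"
  note [simp] = insert.hyps
  have indB: "independent B" using insert.prems(1) independent_mono by blast
  \<comment> \<open>The induction hypothesis makes evaluation at \<open>a\<close> injective on
    \<open>?K\<close>, up to entries outside the index set; simplicity will make it
    surjective.\<close>
  have determined: "y b = 0" if "y \<in> ?K" "y a = 0" "b \<in> insert a B" for y b
  proof (cases "b = a")
    case False
    have "y \<in> annihilator B" using that by (simp add: annihilator_def Yl.zero)
    thus ?thesis using insert.IH[OF indB] that False by auto
  qed (use that in simp)
  have "x a = 0"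
  proof (rule ccontr)
    assume xa: "x a \<noteq> 0"
    have "(\<lambda>y. y a) ` ?K = UNIV"
    proof (rule ideal_UNIV[OF _ _ _ xa])
      show "subspace ((\<lambda>y. y a) ` ?K)"
      proof (rule subspaceI)
        show "0 \<in> (\<lambda>y. y a) ` ?K"
          by (rule image_eqI[of _ _ "\<lambda>_. 0"]) (auto simp: annihilator_def Yl.zero)
      qed (auto intro: rev_image_eqI dest: annihilator_add annihilator_scale)
    next
      fix u n v assume "v \<in> (\<lambda>y. y a) ` ?K"
      then obtain y where "y \<in> ?K" "v = y a" by blast
      moreover have "(\<lambda>b. Y u n (y b)) \<in> ?K" using \<open>y \<in> ?K\<close> by (intro annihilator_Y) simp_all
      ultimately show "Y u n v \<in> (\<lambda>y. y a) ` ?K" by (simp add: rev_image_eqI)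
    qed (use insert.prems in auto)
    hence "\<forall>v. \<exists>y\<in>?K. y a = v" by (metis UNIV_I imageE)
    then obtain F where F: "\<And>v. F v \<in> ?K" "\<And>v. F v a = v" by metis
    have unique: "y b = F (y a) b" if "y \<in> ?K" "b \<in> insert a B" for y b
      using determined[OF annihilator_add[OF that(1) annihilator_scale[OF F(1), of "-1"]] _ that(2)]
      by (simp add: F(2))
    have "\<exists>z. \<forall>v. F v b = sc z v" if b: "b \<in> insert a B" for b
    proof (rule schur)
      show "Vector_Spaces.linear sc sc (\<lambda>v. F v b)"
      proof unfold_locales
        show "F (v + w) b = F v b + F w b" for v w
          using unique[OF annihilator_add[OF F(1) F(1)] b, of v w] by (simp add: F(2))
        show "F (sc z v) b = sc z (F v b)" for z v
          using unique[OF annihilator_scale[OF F(1)] b, of z v] by (simp add: F(2))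
      qed
      show "F (Y u n v) b = Y u n (F v b)" for u n v
        using unique[OF annihilator_Y[OF _ F(1)] b, of u n v] by (simp add: F(2))
    qed
    then obtain z where z: "\<And>b v. b \<in> insert a B \<Longrightarrow> F v b = sc (z b) v" by metis
    have "sc (z a) vac = sc 1 vac" using z[of a vac] F(2)[of vac] by simp
    hence "z a = 1" using vac_nonzero by (simp only: scale_cancel_right) auto
    \<comment> \<open>Mode -1 of the vacuum is the identity, so the family \<open>F vac\<close>
      turns annihilation into a linear relation whose coefficient at \<open>a\<close> is 1.\<close>
    have "(\<Sum>b\<in>insert a B. sc (z b) b) = (\<Sum>b\<in>insert a B. Y (F vac b) (-1) b)"
      by (rule sum.cong) (auto simp: z Yl.scale vacuum)
    also have "\<dots> = 0" using F(1)[of vac] unfolding annihilator_def by blast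
    finally have "z a = 0"
      by (rule independentD[OF insert.prems(1), rotated 2]) auto
    thus False using \<open>z a = 1\<close> by simp
  qed
  thus ?case using determined insert.prems by blast
qed simp

section \<open>Dedekind independence of automorphisms\<close>

lemma automorphisms_independent:
  assumes "finite S" "S \<subseteq> VOA_Aut sc Y om" "\<And>v. (\<Sum>s\<in>S. sc (a s) (s v)) = 0" "s \<in> S"
  shows "a s = 0"
  using assms
proof (induction S arbitrary: a s rule: finite_induct)
  case (insert t S)
  let ?S = "insert t S"
  define B where "B = extend_basis {}"
  have B: "independent B" "span B = UNIV"
    using independent_extend_basis[OF independent_empty] span_extend_basis[OF independent_empty]
    by (auto simp: B_def)
  have in_span: "v \<in> span B" for v by (simp add: B(2))
  note [simp] = insert.hyps
  have bij: "bij s" and hom: "s (Y u n v) = Y (s u) n (s v)" if "s \<in> ?S" for s u n v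
    using subsetD[OF insert.prems(1) that] by (simp_all add: VOA_Aut_def)
  let ?r = "\<lambda>s v. representation B (s v)"
  \<comment> \<open>Apply the relation to \<open>Y u n v\<close> and expand each \<open>s v\<close>
    in the basis: nondegeneracy kills every coefficient. The coordinates \<open>?r s v b\<close>
    take the place of character values in Dedekind's proof.\<close>
  have coord: "(\<Sum>s\<in>?S. sc (a s * ?r s v b) (s u)) = 0" for u v b
  proof -
    \<comment> \<open>Only the finitely many basis vectors occurring in some \<open>s v\<close>
      matter; for other \<open>b\<close> all coordinates are zero.\<close>
    define D where "D = (\<Union>s\<in>?S. {b. ?r s v b \<noteq> 0})"
    define x where "x = (\<lambda>b. \<Sum>s\<in>?S. sc (a s * ?r s v b) (s u))"
    have D: "finite D" by (simp add: D_def finite_representation)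
    have "D \<subseteq> B" unfolding D_def using representation_ne_zero by blast
    hence "independent D" using B independent_mono by blast
    have expand: "(\<Sum>b\<in>D. sc (?r s v b) b) = s v" if "s \<in> ?S" for s
    proof -
      have "(\<Sum>b\<in>D. sc (?r s v b) b) = (\<Sum>b | ?r s v b \<noteq> 0. sc (?r s v b) b)"
        by (rule sum.mono_neutral_right) (use that D in \<open>auto simp: D_def\<close>)
      thus ?thesis using sum_nonzero_representation_eq[OF B(1) in_span] by simp
    qed
    have "x \<in> annihilator D"
      unfolding annihilator_def
    proof (intro CollectI allI)
      fix n
      have "(\<Sum>b\<in>D. Y (x b) n b) = (\<Sum>s\<in>?S. \<Sum>b\<in>D. sc (a s) (Y (s u) n (sc (?r s v b) b)))"
        unfolding x_def Yl.sum by (subst sum.swap) (simp only: Yl.scale Yr.scale scale_scale)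
      also have "\<dots> = (\<Sum>s\<in>?S. sc (a s) (Y (s u) n (s v)))"
        by (rule sum.cong[OF refl]) (simp only: expand scale_sum_right[symmetric] Yr.sum[symmetric])
      also have "\<dots> = (\<Sum>s\<in>?S. sc (a s) (s (Y u n v)))"
        by (rule sum.cong) (simp_all only: hom)
      also have "\<dots> = 0" by (rule insert.prems(2))
      finally show "(\<Sum>b\<in>D. Y (x b) n b) = 0" .
    qed
    hence "b \<in> D \<Longrightarrow> x b = 0"
      using vertex_operator_nondegenerate[OF D \<open>independent D\<close>] by blast
    moreover have "b \<notin> D \<Longrightarrow> x b = 0" by (auto simp: D_def x_def)
    ultimately show ?thesis unfolding x_def by blast
  qed
  have vanish: "a s = 0" if s: "s \<in> S" for s
  proof -
    have "s \<noteq> t" using s insert.hyps by auto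
    then obtain v where "s v \<noteq> t v" by (auto simp: fun_eq_iff)
    then obtain b where b: "?r s v b \<noteq> ?r t v b"
      using sum_nonzero_representation_eq[OF B(1) in_span, of "s v"]
        sum_nonzero_representation_eq[OF B(1) in_span, of "t v"] by force
    \<comment> \<open>Subtracting \<open>?r t v b\<close> times the original relation from
      \<open>coord\<close> cancels the \<open>t\<close> term and leaves a relation on
      \<open>S\<close>.\<close>
    have "(\<Sum>s\<in>S. sc (a s * (?r s v b - ?r t v b)) (s u)) = 0" for u
    proof -
      have "(\<Sum>s\<in>S. sc (a s * (?r s v b - ?r t v b)) (s u))
          = (\<Sum>s\<in>?S. sc (a s * (?r s v b - ?r t v b)) (s u))" by simp
      also have "\<dots> = (\<Sum>s\<in>?S. sc (a s * ?r s v b) (s u) - sc (?r t v b) (sc (a s) (s u)))"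
        by (rule sum.cong) (simp_all add: scale_left_diff_distrib right_diff_distrib mult.commute)
      also have "\<dots> = 0"
        unfolding sum_subtractf scale_sum_right[symmetric] coord insert.prems(2) by simp
      finally show ?thesis .
    qed
    hence "a s * (?r s v b - ?r t v b) = 0"
      using insert.IH[of "\<lambda>s. a s * (?r s v b - ?r t v b)"] insert.prems(1) s by blast
    thus ?thesis using b by simp
  qed
  have "a t = 0"
  proof -
    obtain v where v: "t v = vac" using bij[of t] by (metis bij_pointE insertI1)
    have "sc (a t) vac = 0" using insert.prems(2)[of v] vanish v by simp
    thus ?thesis using vac_nonzero by simp
  qed
  thus ?case using vanish insert.prems(3) by auto
qed simp

section \<open>The Galois group over the fixed points\<close>

lemma Galois_correspondence_fixed_points:
  assumes G: "subgroup G (VOA_Aut_group sc Y om)" "finite G"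
  shows "VOA_Gal sc Y om (fixed_points G) = G"
proof
  have GA: "G \<subseteq> VOA_Aut sc Y om" and comp: "\<And>g k. g \<in> G \<Longrightarrow> k \<in> G \<Longrightarrow> g \<circ> k \<in> G"
    and id: "id \<in> G"
    using subgroup.subset[OF G(1)] subgroup.m_closed[OF G(1)] subgroup.one_closed[OF G(1)]
    by (auto simp: VOA_Aut_group_def)
  show "G \<subseteq> VOA_Gal sc Y om (fixed_points G)"
    using GA by (auto simp: VOA_Gal_def fixed_points_def)
  show "VOA_Gal sc Y om (fixed_points G) \<subseteq> G"
  proof
    fix h assume h: "h \<in> VOA_Gal sc Y om (fixed_points G)"
    have additive: "k (\<Sum>g\<in>G. g v) = (\<Sum>g\<in>G. k (g v))" if "k \<in> VOA_Aut sc Y om" for k v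
      using that module_hom.sum[OF Vector_Spaces.linear.axioms(3)] by (auto simp: VOA_Aut_def)
    have inj: "inj_on ((\<circ>) k) G" if "k \<in> VOA_Aut sc Y om" for k
      using that by (auto simp: VOA_Aut_def bij_def inj_on_def fun_eq_iff)
    have hA: "h \<in> VOA_Aut sc Y om" using h by (simp add: VOA_Gal_def)
    have trace: "(\<Sum>g\<in>G. g v) \<in> fixed_points G" for v
      unfolding fixed_points_def
    proof (intro CollectI ballI)
      fix k assume k: "k \<in> G"
      hence kA: "k \<in> VOA_Aut sc Y om" using GA by auto
      \<comment> \<open>Left translation is an injective self-map of a finite set, hence a
        permutation, so \<open>k\<close> only reorders the sum.\<close>
      have "(\<circ>) k ` G = G" using endo_inj_surj[OF G(2) _ inj[OF kA]] comp k by auto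
      hence "(\<Sum>g\<in>G. g v) = (\<Sum>g\<in>(\<circ>) k ` G. g v)" by simp
      also have "\<dots> = (\<Sum>g\<in>G. k (g v))" by (simp add: sum.reindex[OF inj[OF kA]])
      finally show "k (\<Sum>g\<in>G. g v) = (\<Sum>g\<in>G. g v)" by (rule trans[OF additive[OF kA] sym])
    qed
    let ?H = "(\<circ>) h ` G"
    have HA: "?H \<subseteq> VOA_Aut sc Y om"
    proof
      fix k assume "k \<in> ?H"
      then obtain g where g: "g \<in> VOA_Aut sc Y om" "k = h \<circ> g" using GA by auto
      thus "k \<in> VOA_Aut sc Y om"
        using hA Vector_Spaces.linear_compose[of sc sc g sc h] by (auto simp: VOA_Aut_def bij_comp)
    qed
    have "?H \<inter> G \<noteq> {}"
    proof
      assume disj: "?H \<inter> G = {}"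
      \<comment> \<open>Since \<open>?H\<close> and \<open>G\<close> are assumed disjoint, these
        signs encode the difference of the two coset sums; the coefficient 1 at \<open>id\<close>
        then contradicts independence.\<close>
      define a :: "('v \<Rightarrow> 'v) \<Rightarrow> complex" where "a = (\<lambda>s. if s \<in> G then 1 else - 1)"
      have "(\<Sum>s\<in>G \<union> ?H. sc (a s) (s v)) = 0" for v
      proof -
        have "(\<Sum>s\<in>G \<union> ?H. sc (a s) (s v)) = (\<Sum>s\<in>G. sc (a s) (s v)) + (\<Sum>s\<in>?H. sc (a s) (s v))"
          using disj G(2) by (subst sum.union_disjoint) auto
        also have "(\<Sum>s\<in>G. sc (a s) (s v)) = (\<Sum>g\<in>G. g v)"
          by (rule sum.cong) (auto simp: a_def)
        also have "(\<Sum>s\<in>?H. sc (a s) (s v)) = (\<Sum>s\<in>?H. - s v)"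
          using disj by (intro sum.cong) (auto simp: a_def)
        also have "\<dots> = - h (\<Sum>g\<in>G. g v)"
          by (simp add: sum.reindex[OF inj[OF hA]] sum_negf additive[OF hA])
        also have "h (\<Sum>g\<in>G. g v) = (\<Sum>g\<in>G. g v)"
          using h trace by (auto simp: VOA_Gal_def)
        also have "(\<Sum>g\<in>G. g v) + - (\<Sum>g\<in>G. g v) = 0" by simp
        finally show ?thesis .
      qed
      hence "a id = 0"
        using automorphisms_independent[of "G \<union> ?H" a id] G(2) GA HA id by auto
      thus False using id by (simp add: a_def)
    qed
    then obtain g where g: "g \<in> G" "h \<circ> g \<in> G" by auto
    \<comment> \<open>A right inverse \<open>k\<close> of \<open>g\<close> within \<open>G\<close>
      recovers h = (h g) k as a product of elements of \<open>G\<close>.\<close>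
    then obtain k where k: "k \<in> G" "g \<circ> k = id"
    proof -
      have "(\<circ>) g ` G = G" using endo_inj_surj[OF G(2) _ inj[of g]] comp g(1) GA by auto
      thus ?thesis using id that by (metis imageE)
    qed
    have "(h \<circ> g) \<circ> k \<in> G" using comp g(2) k(1) by blast
    thus "h \<in> G" by (simp add: comp_assoc k(2))
  qed
qed

end

theorem theorem6p9:
  fixes sc :: "complex \<Rightarrow> 'v::ab_group_add \<Rightarrow> 'v"
    and Y :: "'v \<Rightarrow> int \<Rightarrow> 'v \<Rightarrow> 'v"
    and vac om :: 'v and c :: complex
    and G :: "('v \<Rightarrow> 'v) set"
  assumes "simple_VOA sc Y vac om c"
    and "subgroup G (VOA_Aut_group sc Y om)"
    and "finite G"
  shows "VOA_Gal sc Y om (fixed_points G) = G"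
proof -
  have "vector_space sc" using assms(1) by (simp add: simple_VOA_def is_VOA_def)
  then interpret simple_vertex_operator_algebra sc Y vac om c
    using assms(1) by (intro simple_vertex_operator_algebra.intro simple_vertex_operator_algebra_axioms.intro)
  show ?thesis by (rule Galois_correspondence_fixed_points[OF assms(2,3)])
qed

end
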